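(* Let $A$ be any nonempty set of positive integers (finite or infinite). Then, as formal power series, $$C_{111}(x,y,z)=\frac{1}{1-\sum_{a\in A}\frac{x^az(1+(1-y)x^az)}{1+x^az(1+x^az)(1-y)}}.$$
   Context: A composition of $n$ with parts in $A$ is a finite sequence $\sigma=\sigma_1\sigma_2\cdots\sigma_m$ ($m\ge 0$) of elements of $A$ with $\sigma_1+\cdots+\sigma_m=n$; $m$ is its number of parts (the empty composition of $0$ is included). An occurrence of the pattern $111$ in $\sigma$ is an index $i$ with $1\le i\le m-2$ and $\sigma_i=\sigma_{i+1}=\sigma_{i+2}$. $C_{111}(x,y,z)=\sum_{\sigma} x^{n(\sigma)}y^{r(\sigma)}z^{m(\sigma)}$, where the sum runs over all compositions $\sigma$ with parts in $A$, $n(\sigma)$ is the sum of the parts, $m(\sigma)$ the number of parts and $r(\sigma)$ the number of occurrences of $111$ in $\sigma$. *)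

theory Defs
  imports "HOL-Analysis.Infinite_Sum"
begin

definition compositions :: "nat set \<Rightarrow> nat list set" where
  "compositions A = {\<sigma>. set \<sigma> \<subseteq> A}"

(* Lists are indexed from 0, so 1 <= i <= m - 2 becomes i + 2 < m. *)
definition occ111 :: "nat list \<Rightarrow> nat" where
  "occ111 \<sigma> = card {i. i + 2 < length \<sigma> \<and> \<sigma> ! i = \<sigma> ! (i + 1) \<and> \<sigma> ! (i + 1) = \<sigma> ! (i + 2)}"

(* Power series in x, y, z are iterated univariate ones: F $ n $ r $ m is the coefficient of
   x^n y^r z^m. With x outermost, the library's metric on this type is the x-adic one, so
   infinite sums are formal sums: every coefficient of x^n is a finite sum. *)
type_synonym 'a fps3 = "'a fps fps fps"

definition var_x :: "'a::field fps3" where "var_x = fps_X"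
definition var_y :: "'a::field fps3" where "var_y = fps_const fps_X"
definition var_z :: "'a::field fps3" where "var_z = fps_const (fps_const fps_X)"

definition C111 :: "nat set \<Rightarrow> 'a::field fps3" where
  "C111 A = (\<Sum>\<^sub>\<infinity>\<sigma>\<in>compositions A. var_x ^ sum_list \<sigma> * var_y ^ occ111 \<sigma> * var_z ^ length \<sigma>)"

text \<open>
  An infinite sum that does not converge would be \<open>0\<close>, and \<open>f / g\<close> is only a true quotient if
  \<open>g\<close> is invertible. The following facts show that neither matters here: \<open>C111 A\<close> has the
  expected coefficients, the sum over \<open>A\<close> converges, and the denominators are units.
\<close>

lemma fps_has_sum:
  includes fps_syntax
  fixes f :: "'b \<Rightarrow> 'a::ab_group_add fps"
  assumes fin: "\<And>n. finite (S n)" and sub: "\<And>n. S n \<subseteq> A"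
    and zero: "\<And>n a. a \<in> A - S n \<Longrightarrow> f a $ n = 0"
  shows "(f has_sum Abs_fps (\<lambda>n. \<Sum>a\<in>S n. f a $ n)) A"
  unfolding has_sum_def
proof (rule tendsto_fpsI)
  fix n
  show "\<forall>\<^sub>F B in finite_subsets_at_top A. sum f B $ n = Abs_fps (\<lambda>n. \<Sum>a\<in>S n. f a $ n) $ n"
    unfolding eventually_finite_subsets_at_top
  proof (intro exI[of _ "S n"] conjI allI impI)
    fix B assume B: "finite B \<and> S n \<subseteq> B \<and> B \<subseteq> A"
    have "(\<Sum>a\<in>B. f a $ n) = (\<Sum>a\<in>S n. f a $ n)"
      by (rule sum.mono_neutral_right) (use B zero in auto)
    then show "sum f B $ n = Abs_fps (\<lambda>n. \<Sum>a\<in>S n. f a $ n) $ n"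
      by (simp add: fps_sum_nth)
  qed (use fin sub in auto)
qed

lemma finite_compositions:
  assumes "0 \<notin> A"
  shows "finite {\<sigma> \<in> compositions A. sum_list \<sigma> = n}"
proof (rule finite_subset)
  show "finite {\<sigma>. set \<sigma> \<subseteq> {..n} \<and> length \<sigma> \<le> n}"
    by (rule finite_lists_length_le) simp
  have len: "length \<sigma> \<le> sum_list \<sigma>" if "set \<sigma> \<subseteq> A" for \<sigma>
    using that
  proof (induction \<sigma>)
    case (Cons a \<sigma>)
    then have "0 < a" using assms by (metis list.set_intros(1) neq0_conv subsetD)
    then show ?case using Cons by auto
  qed simp
  show "{\<sigma> \<in> compositions A. sum_list \<sigma> = n} \<subseteq> {\<sigma>. set \<sigma> \<subseteq> {..n} \<and> length \<sigma> \<le> n}"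
    using len member_le_sum_list by (fastforce simp: compositions_def)
qed

lemma monomial_nth:
  includes fps_syntax
  shows
  "(var_x ^ n * var_y ^ r * var_z ^ m :: 'a::field fps3) $ k =
     (if k = n then fps_X ^ r * fps_const (fps_X ^ m) else 0)"
  by (simp add: var_x_def var_y_def var_z_def fps_X_power_mult_nth mult.assoc)

lemma C111_has_sum:
  includes fps_syntax
  assumes "0 \<notin> A"
  shows "((\<lambda>\<sigma>. var_x ^ sum_list \<sigma> * var_y ^ occ111 \<sigma> * var_z ^ length \<sigma> :: 'a::field fps3)
    has_sum C111 A) (compositions A)"
proof -
  have "((\<lambda>\<sigma>. var_x ^ sum_list \<sigma> * var_y ^ occ111 \<sigma> * var_z ^ length \<sigma> :: 'a fps3)
    has_sum Abs_fps (\<lambda>n. \<Sum>\<sigma>\<in>{\<sigma> \<in> compositions A. sum_list \<sigma> = n}.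
      (var_x ^ sum_list \<sigma> * var_y ^ occ111 \<sigma> * var_z ^ length \<sigma>) $ n)) (compositions A)"
    by (rule fps_has_sum) (use finite_compositions[OF assms] in \<open>auto simp: monomial_nth\<close>)
  then show ?thesis by (simp add: C111_def infsumI)
qed

lemma C111_nth:
  includes fps_syntax
  assumes "0 \<notin> A"
  shows "(C111 A :: 'a::field fps3) $ n $ r $ m =
    of_nat (card {\<sigma> \<in> compositions A. sum_list \<sigma> = n \<and> occ111 \<sigma> = r \<and> length \<sigma> = m})"
proof -
  let ?S = "{\<sigma> \<in> compositions A. sum_list \<sigma> = n}"
  have "((\<lambda>\<sigma>. var_x ^ sum_list \<sigma> * var_y ^ occ111 \<sigma> * var_z ^ length \<sigma> :: 'a fps3)
    has_sum Abs_fps (\<lambda>n. \<Sum>\<sigma>\<in>{\<sigma> \<in> compositions A. sum_list \<sigma> = n}.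
      (var_x ^ sum_list \<sigma> * var_y ^ occ111 \<sigma> * var_z ^ length \<sigma>) $ n)) (compositions A)"
    by (rule fps_has_sum) (use finite_compositions[OF assms] in \<open>auto simp: monomial_nth\<close>)
  then have "(C111 A :: 'a fps3) $ n $ r $ m =
      (\<Sum>\<sigma>\<in>?S. (fps_X ^ occ111 \<sigma> * fps_const (fps_X ^ length \<sigma>)) $ r $ m)"
    by (simp add: C111_def infsumI monomial_nth fps_sum_nth)
  also have "\<dots> = (\<Sum>\<sigma>\<in>?S. if occ111 \<sigma> = r \<and> length \<sigma> = m then 1 else 0)"
    by (intro sum.cong refl) (auto simp: fps_X_power_mult_nth)
  also have "\<dots> = of_nat (card {\<sigma> \<in> ?S. occ111 \<sigma> = r \<and> length \<sigma> = m})"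
    using finite_compositions[OF assms, of n] by (simp add: sum.If_cases Int_def)
  also have "{\<sigma> \<in> ?S. occ111 \<sigma> = r \<and> length \<sigma> = m} =
      {\<sigma> \<in> compositions A. sum_list \<sigma> = n \<and> occ111 \<sigma> = r \<and> length \<sigma> = m}" by auto
  finally show ?thesis .
qed

lemma divide_fps3_cancel:
  includes fps_syntax
  fixes f g :: "'a::field fps3"
  assumes "g $ 0 = 1"
  shows "f / g * g = f"
proof -
  have "g * inverse g = 1"
    using fps_right_inverse[of g 1] assms
    by (simp add: fps_inverse_def[of g] fps_inverse_one')
  then show ?thesis
    using assms by (simp add: fps_divide_def mult.assoc mult.commute[of _ g])
qed

lemma term111_denominator_nth_0:
  includes fps_syntax
  assumes "a > 0"
  shows "(1 + var_x ^ a * var_z * (1 + var_x ^ a * var_z) * (1 - var_y) :: 'a::field fps3) $ 0 = 1"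
  using assms by (simp add: var_x_def)

lemma fps_nth_var_x_power_mult:
  "n < a \<Longrightarrow> fps_nth (var_x ^ a * f) n = 0"
  by (simp add: var_x_def fps_X_power_mult_nth)

lemma term111_has_sum:
  includes fps_syntax
  assumes "0 \<notin> A"
  defines "t \<equiv> \<lambda>a. var_x ^ a * var_z * (1 + (1 - var_y) * var_x ^ a * var_z)
        / (1 + var_x ^ a * var_z * (1 + var_x ^ a * var_z) * (1 - var_y)) :: 'a::field fps3"
  shows "(t has_sum Abs_fps (\<lambda>n. \<Sum>a\<in>{a \<in> A. a \<le> n}. t a $ n)) A"
proof (rule fps_has_sum)
  fix n a assume a: "a \<in> A - {a \<in> A. a \<le> n}"
  then have "a > 0" "n < a" using assms by (auto intro: gr0I)
  let ?d = "1 + var_x ^ a * var_z * (1 + var_x ^ a * var_z) * (1 - var_y) :: 'a fps3"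
  have "?d $ 0 \<noteq> 0"
    using term111_denominator_nth_0[OF \<open>a > 0\<close>, where 'a = 'a] by (metis one_neq_zero)
  then have "t a = var_x ^ a * (var_z * (1 + (1 - var_y) * var_x ^ a * var_z) * inverse ?d)"
    unfolding t_def by (subst fps_divide_unit) (simp_all only: mult.assoc not_False_eq_True)
  then show "t a $ n = 0"
    using fps_nth_var_x_power_mult[OF \<open>n < a\<close>] by metis
qed auto

lemma C111_denominator_nth_0:
  includes fps_syntax
  assumes "0 \<notin> A"
  shows "(1 - (\<Sum>\<^sub>\<infinity>a\<in>A.
      (var_x ^ a * var_z * (1 + (1 - var_y) * var_x ^ a * var_z))
      / (1 + var_x ^ a * var_z * (1 + var_x ^ a * var_z) * (1 - var_y))) :: 'a::field fps3) $ 0 = 1"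
proof -
  have "{a \<in> A. a \<le> 0} = {}" using assms by auto
  then show ?thesis
    unfolding infsumI[OF term111_has_sum[OF assms]]
    by (simp only: fps_sub_nth fps_one_nth fps_nth_Abs_fps sum.empty) simp
qed

end

(* Fix a part a and write w = x^a z. Prepending a to a composition multiplies its weight by w,
   and by a further y exactly if the composition starts with a a. So if T and U are the
   generating functions of the compositions starting with a and with a a, then
   T = w C - w (1 - y) U and U = w T - w (1 - y) U. Eliminating U gives T = t C, where t is the
   summand for a on the right-hand side. Summing over a yields C = 1 + C * (sum of the t). *)
theory Submission
  imports Defs "HOL-Analysis.Elementary_Metric_Spaces"
begin

text \<open>Near a given series each fixed coefficient is constant, and addition acts
  coefficientwise. Continuity of addition lets formal sums be added and iterated.\<close>

instance fps :: (ab_group_add) topological_comm_monoid_add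
proof
  fix f g :: "'a fps"
  show "((\<lambda>p. fst p + snd p) \<longlongrightarrow> f + g) (nhds f \<times>\<^sub>F nhds g)"
  proof (rule tendsto_fpsI)
    fix n
    have "\<forall>\<^sub>F p in nhds f \<times>\<^sub>F nhds g.
        fps_nth (fst p) n = fps_nth f n \<and> fps_nth (snd p) n = fps_nth g n"
      by (rule eventually_prodI) (rule eventually_fps_nth_eq_nhds_fps)+
    then show "\<forall>\<^sub>F p in nhds f \<times>\<^sub>F nhds g. fps_nth (fst p + snd p) n = fps_nth (f + g) n"
      by eventually_elim simp
  qed
qed

text \<open>Coefficient \<open>n\<close> of a product involves only the coefficients up to
  \<open>n\<close> of both factors, and these are all constant near \<open>f\<close> and
  \<open>g\<close>. This lets constant factors move through formal sums.\<close>

instance fps :: (ring) topological_semigroup_mult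
proof
  fix f g :: "'a fps"
  show "((\<lambda>p. fst p * snd p) \<longlongrightarrow> f * g) (nhds f \<times>\<^sub>F nhds g)"
  proof (rule tendsto_fpsI)
    fix n
    have "\<forall>\<^sub>F p in nhds f \<times>\<^sub>F nhds g.
        (\<forall>k\<le>n. fps_nth (fst p) k = fps_nth f k) \<and> (\<forall>k\<le>n. fps_nth (snd p) k = fps_nth g k)"
      by (rule eventually_prodI) (rule eventually_fps_nth_eq_nhds_fps_strong)+
    then show "\<forall>\<^sub>F p in nhds f \<times>\<^sub>F nhds g. fps_nth (fst p * snd p) n = fps_nth (f * g) n"
      by eventually_elim (simp add: fps_mult_nth)
  qed
qed

lemma occ111_Nil [simp]: "occ111 [] = 0"
  by (simp add: occ111_def)

text \<open>Occurrences in \<sigma> reappear shifted by one; the only possible new one is at index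
  0, and it needs \<sigma> to begin with a a.\<close>

lemma occ111_Cons:
  "occ111 (a # \<sigma>) = occ111 \<sigma> + (if \<exists>\<tau>. \<sigma> = a # a # \<tau> then 1 else 0)"
proof -
  define P where "P \<sigma> i \<longleftrightarrow>
    i + 2 < length \<sigma> \<and> \<sigma> ! i = \<sigma> ! (i + 1) \<and> \<sigma> ! (i + 1) = \<sigma> ! (i + 2)" for \<sigma> :: "nat list" and i
  have fin: "finite {i. P \<sigma> i}"
    by (rule finite_subset[of _ "{..<length \<sigma>}"]) (auto simp: P_def)
  have start: "P (a # \<sigma>) 0 \<longleftrightarrow> (\<exists>\<tau>. \<sigma> = a # a # \<tau>)"
    by (cases \<sigma> rule: list.exhaust; cases "tl \<sigma>") (auto simp: P_def)
  have "P (a # \<sigma>) (Suc i) \<longleftrightarrow> P \<sigma> i" for i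
    by (simp add: P_def)
  then have "{i. P (a # \<sigma>) i} = Suc ` {i. P \<sigma> i} \<union> (if P (a # \<sigma>) 0 then {0} else {})"
    by (auto simp: image_iff) (metis not0_implies_Suc)+
  moreover have "occ111 \<sigma> = card {i. P \<sigma> i}" for \<sigma>
    by (simp add: occ111_def P_def)
  ultimately show ?thesis
    using fin by (simp add: card_image start)
qed

definition weight :: "nat list \<Rightarrow> 'a::field fps3" where
  "weight \<sigma> = var_x ^ sum_list \<sigma> * var_y ^ occ111 \<sigma> * var_z ^ length \<sigma>"

lemma weight_Nil [simp]: "weight [] = 1"
  by (simp add: weight_def)

text \<open>The factor y of a new occurrence is split as 1 + (y - 1). The first summand then has the
  same form for every \<sigma>, and only the correction depends on how \<sigma> begins.\<close>

lemma weight_Cons: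
  "(weight (a # \<sigma>) :: 'a::field fps3) = var_x ^ a * var_z * weight \<sigma> +
    (if \<exists>\<tau>. \<sigma> = a # a # \<tau> then var_x ^ a * var_z * (var_y - 1) * weight \<sigma> else 0)"
  unfolding weight_def occ111_Cons by (simp add: power_add algebra_simps)

text \<open>Only the finitely many compositions of n contribute to the coefficient of x^n.\<close>

lemma weight_summable:
  assumes "0 \<notin> A" "S \<subseteq> compositions A"
  shows "(weight :: _ \<Rightarrow> 'a::field fps3) summable_on S"
proof -
  have "finite {\<sigma> \<in> S. sum_list \<sigma> = n}" for n
    by (rule finite_subset[OF _ finite_compositions[OF assms(1), of n]]) (use assms(2) in auto)
  then have "((weight :: _ \<Rightarrow> 'a fps3) has_sum
      Abs_fps (\<lambda>n. \<Sum>\<sigma>\<in>{\<sigma> \<in> S. sum_list \<sigma> = n}. fps_nth (weight \<sigma>) n)) S"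
    by (intro fps_has_sum) (auto simp: weight_def monomial_nth)
  then show ?thesis
    by (rule has_sum_imp_summable)
qed

text \<open>Summing \<open>weight_Cons\<close> over \<open>S\<close> gives a multiple of the full
  sum and a correction living on the lists that begin with a a. Keeping \<open>S\<close> general
  serves both all compositions and those beginning with a.\<close>

lemma infsum_weight_Cons:
  fixes a :: nat
  defines "R \<equiv> range (\<lambda>\<tau>. a # a # \<tau>)"
  assumes "0 \<notin> A" "S \<subseteq> compositions A"
  shows "(infsum weight (Cons a ` S) :: 'a::field fps3) =
    var_x ^ a * var_z * (infsum weight S - (1 - var_y) * infsum weight (S \<inter> R))"
proof -
  let ?w = "var_x ^ a * var_z :: 'a fps3"
  have "((\<lambda>\<sigma>. ?w * weight \<sigma>) has_sum ?w * infsum weight S) S"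
    by (intro has_sum_cmult_right has_sum_infsum weight_summable[OF assms(2,3)])
  moreover have "((\<lambda>\<sigma>. ?w * (var_y - 1) * weight \<sigma>) has_sum
      ?w * (var_y - 1) * infsum weight (S \<inter> R)) (S \<inter> R)"
    by (intro has_sum_cmult_right has_sum_infsum weight_summable[OF assms(2)])
      (use assms(3) in auto)
  \<comment> \<open>The correction vanishes outside \<open>R\<close>, so its sum over
    \<open>S \<inter> R\<close> is also its sum over \<open>S\<close>.\<close>
  then have "((\<lambda>\<sigma>. if \<exists>\<tau>. \<sigma> = a # a # \<tau> then ?w * (var_y - 1) * weight \<sigma> else 0) has_sum
      ?w * (var_y - 1) * infsum weight (S \<inter> R)) S"
    by (rule has_sum_cong_neutral[THEN iffD1, rotated -1]) (auto simp: R_def)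
  ultimately have "((\<lambda>\<sigma>. weight (a # \<sigma>)) has_sum
      ?w * infsum weight S + ?w * (var_y - 1) * infsum weight (S \<inter> R)) S"
    unfolding weight_Cons by (rule has_sum_add)
  then have "(weight has_sum
      ?w * infsum weight S + ?w * (var_y - 1) * infsum weight (S \<inter> R)) (Cons a ` S)"
    by (subst has_sum_reindex) (auto simp: o_def)
  then show ?thesis
    by (simp add: infsumI algebra_simps)
qed

lemma infsum_weight_starting_with:
  assumes "0 \<notin> A" "a \<in> A"
  shows "(infsum weight (Cons a ` compositions A) :: 'a::field fps3) =
    (var_x ^ a * var_z * (1 + (1 - var_y) * var_x ^ a * var_z))
      / (1 + var_x ^ a * var_z * (1 + var_x ^ a * var_z) * (1 - var_y)) * C111 A"
    (is "?T = ?n / ?d * _")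
proof -
  let ?comps = "compositions A"
  let ?R = "range (\<lambda>\<tau>. a # a # \<tau>)"
  let ?w = "var_x ^ a * var_z :: 'a fps3"
  define U :: "'a fps3" where "U = infsum weight (Cons a ` Cons a ` ?comps)"
  have C: "infsum weight ?comps = (C111 A :: 'a fps3)"
    by (simp add: C111_def weight_def[abs_def])
  have sub: "Cons a ` ?comps \<subseteq> ?comps"
    using assms(2) by (auto simp: compositions_def)
  \<comment> \<open>Both uses of \<open>infsum_weight_Cons\<close> have their correction on the same
    set, so the two equations involve no series beyond \<open>?T\<close>, \<open>U\<close> and
    \<open>C111 A\<close>.\<close>
  have inter: "?comps \<inter> ?R = Cons a ` Cons a ` ?comps"
      "Cons a ` ?comps \<inter> ?R = Cons a ` Cons a ` ?comps"
    using assms(2) by (auto simp: compositions_def image_iff)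
  have T: "?T = ?w * (C111 A - (1 - var_y) * U)"
    using infsum_weight_Cons[OF assms(1) order_refl, of a, where 'a = 'a]
    by (simp only: inter C U_def)
  have U: "U = ?w * (?T - (1 - var_y) * U)"
    using infsum_weight_Cons[OF assms(1) sub, of a, where 'a = 'a] by (simp only: inter U_def)
  \<comment> \<open>Elimination with X, Y, Z, w, q in place of \<open>?T\<close>,
    \<open>C111 A\<close>, \<open>U\<close>, \<open>?w\<close> and 1 - y.\<close>
  have "X * (1 + w * (1 + w) * q) = w * (1 + q * w) * Y"
    if "X = w * (Y - q * Z)" "Z = w * (X - q * Z)" for X Y Z w q :: "'a fps3"
  proof -
    have "w * (X - q * Z) + w * q * Z = w * X" "w * (Y - q * Z) + w * q * Z = w * Y"
      by (simp_all add: algebra_simps)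
    then have wX: "w * X = Z + w * q * Z" and wY: "w * Y = X + w * q * Z"
      by (simp_all only: that[symmetric])
    \<comment> \<open>Since w X = (1 + w q) Z, both summands contain the factor 1 + w q; pulling it
      out leaves X + w q Z, which is w Y, and Z is gone.\<close>
    have "X * (1 + w * (1 + w) * q) = X * (1 + w * q) + w * q * (w * X)"
      by (simp add: algebra_simps)
    also have "\<dots> = (1 + q * w) * (w * Y)"
      unfolding wX wY by (simp add: algebra_simps)
    finally show ?thesis
      by (simp add: algebra_simps)
  qed
  from this[OF T U] have "?T * ?d = ?n * C111 A"
    by (simp only: mult.assoc)
  moreover have d0: "fps_nth ?d 0 = 1"
    by (rule term111_denominator_nth_0) (use assms in \<open>auto intro: gr0I\<close>)
  \<comment> \<open>Brings \<open>?d\<close> next to the quotient, where it cancels because its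
    coefficient of x^0 is 1.\<close>
  have "u * v * w = u * w * v" for u v w :: "'a fps3"
    by (simp add: mult_ac)
  from this[of "?n / ?d" ?d "C111 A"] have "?n * C111 A = ?n / ?d * C111 A * ?d"
    by (simp only: divide_fps3_cancel[OF d0])
  ultimately have "?T * ?d = ?n / ?d * C111 A * ?d"
    by (rule trans)
  moreover have "?d \<noteq> 0"
    using d0 by (metis fps_zero_nth zero_neq_one)
  ultimately show ?thesis
    by (rule mult_right_cancel[THEN iffD1, rotated])
qed

theorem theorem1:
  fixes A :: "nat set"
  assumes "A \<noteq> {}" and "\<forall>a\<in>A. a > 0"
  shows "(C111 A :: 'a::field fps3) =
    1 / (1 - (\<Sum>\<^sub>\<infinity>a\<in>A.
      (var_x ^ a * var_z * (1 + (1 - var_y) * var_x ^ a * var_z))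
      / (1 + var_x ^ a * var_z * (1 + var_x ^ a * var_z) * (1 - var_y))))"
proof -
  define t :: "nat \<Rightarrow> 'a fps3" where
    "t a = (var_x ^ a * var_z * (1 + (1 - var_y) * var_x ^ a * var_z))
      / (1 + var_x ^ a * var_z * (1 + var_x ^ a * var_z) * (1 - var_y))" for a
  define s where "s = infsum t A"
  define C :: "'a fps3" where "C = C111 A"
  let ?comps = "compositions A"
  have A: "0 \<notin> A" using assms(2) by auto
  \<comment> \<open>Without convergence \<open>s\<close> would be the default value 0.\<close>
  have "t summable_on A"
    unfolding t_def by (rule has_sum_imp_summable[OF term111_has_sum[OF A]])
  then have 1: "((\<lambda>a. t a * C) has_sum s * C) A"
    unfolding s_def by (intro has_sum_cmult_left has_sum_infsum)
  have C: "(weight has_sum C) ?comps"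
    using C111_has_sum[OF A, where 'a = 'a] by (simp add: C_def weight_def[abs_def])
  define V :: "'a fps3" where "V = infsum weight (?comps - {[]})"
  have V: "(weight has_sum V) (?comps - {[]})"
    unfolding V_def by (intro has_sum_infsum weight_summable[OF A]) auto
  \<comment> \<open>The empty composition contributes the 1 in C = 1 + V.\<close>
  have "[] \<in> ?comps" by (simp add: compositions_def)
  then have "(weight has_sum 1 + V) ?comps"
    using has_sum_insert[OF _ V, of "[]"] by (simp add: insert_absorb)
  then have CV: "C = 1 + V"
    using C by (rule has_sum_unique[rotated])
  \<comment> \<open>Splitting off the first part turns \<open>V\<close> into a double sum over the
    first part and the remaining composition.\<close>
  have img: "?comps - {[]} = (\<lambda>(a, \<sigma>). a # \<sigma>) ` (A \<times> ?comps)"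
  proof (intro equalityI subsetI)
    fix \<sigma> assume "\<sigma> \<in> ?comps - {[]}"
    then show "\<sigma> \<in> (\<lambda>(a, \<sigma>). a # \<sigma>) ` (A \<times> ?comps)"
      by (cases \<sigma>) (auto simp: compositions_def)
  qed (auto simp: compositions_def)
  have "((\<lambda>p. weight (fst p # snd p)) has_sum V) (A \<times> ?comps)"
    using V unfolding img
    by (subst (asm) has_sum_reindex) (auto simp: inj_on_def o_def case_prod_beta)
  moreover have "((\<lambda>\<sigma>. weight (fst (a, \<sigma>) # snd (a, \<sigma>))) has_sum t a * C) ?comps" if "a \<in> A" for a
  proof -
    have "Cons a ` ?comps \<subseteq> ?comps"
      using that by (auto simp: compositions_def)
    then have "(weight has_sum t a * C) (Cons a ` ?comps)"
      using has_sum_infsum[OF weight_summable[OF A]] infsum_weight_starting_with[OF A that]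
      unfolding t_def C_def by metis
    then show ?thesis
      by (subst (asm) has_sum_reindex) (auto simp: o_def)
  qed
  \<comment> \<open>Summing over the remaining compositions first gives \<open>t a * C\<close> for
    each a, so \<open>V\<close> and \<open>s * C\<close> are sums of the same family.\<close>
  ultimately have "((\<lambda>a. t a * C) has_sum V) A"
    by (rule has_sum_SigmaD[where f = "\<lambda>p. weight (fst p # snd p)" and B = "\<lambda>_. ?comps"])
  with 1 have "V = s * C"
    by (rule has_sum_unique[rotated])
  with CV have eq: "C * (1 - s) = 1"
    by (simp add: algebra_simps)
  \<comment> \<open>The coefficient of x^0 in 1 - s is 1, so this is a true quotient.\<close>
  have "1 / (1 - s) * (1 - s) = 1"
    using C111_denominator_nth_0[OF A, where 'a = 'a]
    by (intro divide_fps3_cancel) (simp only: s_def t_def[abs_def])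
  with eq have "C * (1 - s) = 1 / (1 - s) * (1 - s)"
    by (simp only:)
  moreover have "1 - s \<noteq> 0"
    using eq by (metis mult_zero_right zero_neq_one)
  ultimately have "C = 1 / (1 - s)"
    by (rule mult_right_cancel[THEN iffD1, rotated])
  then show ?thesis
    by (simp only: C_def s_def t_def[abs_def])
qed

end
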